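(* Fix a decision time $u$, a horizon $\Delta>0$, an execution policy $\Pi_u$ and an operating set $\mathcal U^{\mathrm{op}}_u(\Delta)$. Suppose: (i) the planned sale cap $\widehat x_u=\min\widehat{\mathcal F}_{u,\Delta}(q)$ exists, i.e. $\widehat{\mathcal F}_{u,\Delta}(q)\neq\varnothing$; (ii) the realized path $\omega$ belongs to $\mathcal U^{\mathrm{op}}_u(\Delta)$; (iii) the actual market close time satisfies $T_c^{\mathrm{act}}(\omega)>u+\Delta$; (iv) risk-reducing execution authority, collateral non-escape with loan priority, and settlement observability and finality hold throughout the horizon $[u,u+\Delta]$; (v) the policy submits risk-reducing sales, applies every confirmed net proceed debt-first, and continues until either the debt is zero or the cumulative settled quantity reaches $\widehat x_u$; every submitted fill used by the policy settles by $u+\Delta$; and (vi) no new borrowing is created after $u$. Then by some time $\sigma\le u+\Delta$, $$D_{\sigma^+}=0\qquad\text{and}\qquad Z_\sigma\ge 0,$$ where $Z_\sigma$ is the confirmed dedicated cash remaining after debt repayment. Moreover, if the policy is configured to continue until confirmed cash covers the realized debt plus $m_u$ (or if the entire certified cap $\widehat x_u$ settles), then at the corresponding completion time $\sigma_m\le u+\Delta$, $$D_{\sigma_m^+}=0\qquad\text{and}\qquad Z_{\sigma_m}\ge m_u .$$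
   Context: Setting. Paths $\omega$ are elements of a filtered probability space $(\Omega,\mathcal F,(\mathcal F_t),\mathbb P)$. At decision time $u$ a position holds a settled quantity $q$ of an outcome token, dedicated confirmed cash $K_u\ge0$ and debt $D_u>0$. $\mathcal Q_u(q)=\{0=y_0<y_1<\dots<y_m\le q\}$ is a finite grid of admissible cumulative sale quantities. The operating set is a subset $\mathcal U^{\mathrm{op}}_u(\Delta)\subseteq\Omega$. Proceeds. For an $\mathcal F_u$-measurable execution policy $\Pi$ and a cumulative sale cap $x$, $B^{\mathrm{set},\Pi}_{u,\Delta}(x,\omega)$ denotes the net sale proceeds confirmed and available for debt repayment by time $u+\Delta$ on path $\omega$ when the policy is run against cap $x$ (matched but unsettled fills are not counted). It is a capacity curve: a live controller may stop at an earlier confirmed prefix once its target is met; if the full cap $x$ settles, total confirmed sale proceeds are $B^{\mathrm{set},\Pi}_{u,\Delta}(x,\omega)$. The lower envelope is $\underline B^{\Pi}_{u,\Delta}(x)=\inf_{\omega\in\mathcal U^{\mathrm{op}}_u(\Delta)}B^{\mathrm{set},\Pi}_{u,\Delta}(x,\omega)$. Debt. Let $P_{u,t}$ be the cumulative confirmed cash applied to the loan after $u$ and up to $t$ (from dedicated account cash and from settled sale proceeds). The debt satisfies $D_t=\left[D_u+\int_u^t r_sD_s\,ds+C^{\mathrm{debt}}_{u,t}-P_{u,t}\right]^+$ for $t\ge u$, until extinction, where $[\cdot]^+$ is the positive part, $r_s\ge0$ is the borrowing rate and $C^{\mathrm{debt}}_{u,t}$ are charges contractually added after $u$; no debt accrues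 after extinction. The debt-service requirement is $H^{\Pi}_{u,t}(\omega)=P^{\Pi}_{u,t}(\omega)+D^{\Pi}_t(\omega)$ and its upper envelope is $\overline H_{u,\Delta}=\sup_{\omega\in\mathcal U^{\mathrm{op}}_u(\Delta)}H^{\Pi}_{u,u+\Delta}(\omega)$. Planned sale. With a buffer $m_u\ge0$, $\widehat{\mathcal F}_{u,\Delta}(q)=\{x\in\mathcal Q_u(q):K_u+\underline B^{\Pi}_{u,\Delta}(x)\ge\overline H_{u,\Delta}+m_u\}$ and $\widehat x_u=\min\widehat{\mathcal F}_{u,\Delta}(q)$ if this set is non-empty. Debt-first application. Whenever a settled increment of proceeds $\Delta b$ is confirmed while debt is $D$ and dedicated cash is $K$, the payment is $p=\min\{D,K+\Delta b\}$; debt becomes $D-p$ and dedicated cash becomes $K+\Delta b-p$. Named conditions. Execution authority: while debt is positive the controller can submit, replace, cancel and settle permitted risk-reducing orders for the position without a new discretionary borrower signature. Collateral non-escape and loan priority: while debt is positive the borrower cannot withdraw, transfer, re-pledge or otherwise remove the financed tokens and dedicated cash, and settled sale proceeds are applied to the loan before any residual value is released. Settlement observability and finality: the mechanism can identify which matched fills have become final; a fill reduces debt only after its collateral receipt is confirmed and cannot be reversed by an ordinary retry. $T_c^{\mathrm{act}}$ is the first time at which risk-reducing orders are no longer accepted. *)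

theory Defs
  imports "HOL-Probability.Probability" "HOL-Library.Sublist"
begin

text \<open>
  A fill is a matched sale. \<open>settle_time\<close> is the time at which its collateral receipt is confirmed,
  so at time \<open>t\<close> a fill with \<open>settle_time f > t\<close> is matched but not settled. A fill that never
  becomes final is given any time beyond the horizon. \<open>proceeds\<close> is net of all costs.
\<close>

record fill =
  fill_qty :: real
  proceeds :: real
  settle_time :: real

datatype order_action = Submit | Replace | Cancel | Settle

text \<open>
  All data of one position from the decision time \<open>u\<close> on. \<open>'w\<close> is the type of paths, \<open>'p\<close> the type
  of execution policies. \<open>debt0\<close>, \<open>cash0\<close>, \<open>token_qty\<close> are the state at \<open>u\<close> before any application
  of cash. Processes take the time first and the path second:

  \<^item> \<open>execution p x \<omega>\<close> lists the fills obtained when policy \<open>p\<close> is run from \<open>u\<close> against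
    the cap \<open>x\<close> and is never stopped early; \<open>live \<omega>\<close> lists the fills the controller actually uses.
  \<^item> \<open>charges\<close>, \<open>paid\<close>, \<open>borrowed\<close> are cumulative amounts after \<open>u\<close> and up to and including \<open>t\<close>
    (\<open>borrowed\<close>: new principal drawn). \<open>debt S t \<omega>\<close> is the balance after the payments made at \<open>t\<close>.
  \<^item> \<open>tokens_removed\<close>, \<open>cash_removed\<close> (by the borrower) and \<open>released\<close> (residual value paid out)
    are cumulative amounts over \<open>[u, t)\<close>, so that an outflow at \<open>t\<close> comes after a loan payment at \<open>t\<close>.
  \<^item> \<open>may a t \<omega>\<close>: the controller can perform \<open>a\<close> on permitted risk-reducing orders at \<open>t\<close> without
    a new discretionary borrower signature; \<open>accepts t \<omega>\<close>: the market accepts such orders.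
  \<^item> \<open>credited i t \<omega>\<close>: at \<open>t\<close> the mechanism treats the \<open>i\<close>-th live fill as final.
  \<^item> \<open>first_applied \<omega>\<close>: the time at which the dedicated cash is first put through the debt-first rule.
\<close>

record ('w, 'p) position =
  token_qty :: real
  cash0 :: real
  debt0 :: real
  buffer :: real
  grid :: "real set"
  execution :: "'p \<Rightarrow> real \<Rightarrow> 'w \<Rightarrow> fill list"
  live :: "'w \<Rightarrow> fill list"
  rate :: "real \<Rightarrow> 'w \<Rightarrow> real"
  charges :: "real \<Rightarrow> 'w \<Rightarrow> real"
  borrowed :: "real \<Rightarrow> 'w \<Rightarrow> real"
  paid :: "real \<Rightarrow> 'w \<Rightarrow> real"
  debt :: "real \<Rightarrow> 'w \<Rightarrow> real"
  tokens_removed :: "real \<Rightarrow> 'w \<Rightarrow> real"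
  cash_removed :: "real \<Rightarrow> 'w \<Rightarrow> real"
  released :: "real \<Rightarrow> 'w \<Rightarrow> real"
  may :: "order_action \<Rightarrow> real \<Rightarrow> 'w \<Rightarrow> bool"
  accepts :: "real \<Rightarrow> 'w \<Rightarrow> bool"
  credited :: "nat \<Rightarrow> real \<Rightarrow> 'w \<Rightarrow> bool"
  first_applied :: "'w \<Rightarrow> real"


subsection \<open>Debt\<close>

definition accrued_debt :: "('w, 'p) position \<Rightarrow> real \<Rightarrow> real \<Rightarrow> 'w \<Rightarrow> real" where
  "accrued_debt S u t \<omega> =
     debt0 S + (LBINT s:{u..t}. rate S s \<omega> * debt S s \<omega>) + charges S t \<omega>"

definition extinct_before :: "('w, 'p) position \<Rightarrow> real \<Rightarrow> real \<Rightarrow> 'w \<Rightarrow> bool" where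
  "extinct_before S u t \<omega> \<longleftrightarrow> (\<exists>s\<in>{u..<t}. accrued_debt S u s \<omega> - paid S s \<omega> \<le> 0)"

text \<open>
  The balance at \<open>t\<close> if the payments counted so far are \<open>a\<close>. With \<open>a = paid S t \<omega>\<close> this is the
  right-hand side of the debt equation, stopped at extinction; with a smaller \<open>a\<close> it is the balance
  met by a payment at \<open>t\<close>.
\<close>

definition debt_owed :: "('w, 'p) position \<Rightarrow> real \<Rightarrow> real \<Rightarrow> real \<Rightarrow> 'w \<Rightarrow> real" where
  "debt_owed S u a t \<omega> =
     (if extinct_before S u t \<omega> then 0 else max 0 (accrued_debt S u t \<omega> - a))"

text \<open>The debt equation has no term for new principal, so it is only imposed while none is drawn.\<close>

definition debt_dynamics :: "('w, 'p) position \<Rightarrow> real \<Rightarrow> 'w \<Rightarrow> bool" where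
  "debt_dynamics S u \<omega> \<longleftrightarrow>
     (\<forall>t\<ge>u. 0 \<le> rate S t \<omega>) \<and>
     charges S u \<omega> = 0 \<and> mono_on {u..} (\<lambda>t. charges S t \<omega>) \<and>
     (\<forall>t\<ge>u. set_integrable lborel {u..t} (\<lambda>s. rate S s \<omega> * debt S s \<omega>)) \<and>
     (\<forall>t\<ge>u. (\<forall>s\<in>{u..t}. borrowed S s \<omega> = 0) \<longrightarrow>
        debt S t \<omega> = debt_owed S u (paid S t \<omega>) t \<omega>)"

definition debt_service :: "('w, 'p) position \<Rightarrow> real \<Rightarrow> 'w \<Rightarrow> real" where
  "debt_service S t \<omega> = paid S t \<omega> + debt S t \<omega>"


subsection \<open>Proceeds and the planned sale\<close>

text \<open>Runs are listed in the order of confirmation.\<close>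

definition valid_run :: "real \<Rightarrow> real \<Rightarrow> fill list \<Rightarrow> bool" where
  "valid_run u x fs \<longleftrightarrow>
     sorted (map settle_time fs) \<and>
     (\<forall>f\<in>set fs. u \<le> settle_time f \<and> 0 < fill_qty f) \<and>
     sum_list (map fill_qty fs) \<le> x"

definition settled_by :: "real \<Rightarrow> fill list \<Rightarrow> fill list" where
  "settled_by t fs = filter (\<lambda>f. settle_time f \<le> t) fs"

definition set_proceeds ::
    "('w, 'p) position \<Rightarrow> ('w \<Rightarrow> 'p) \<Rightarrow> real \<Rightarrow> real \<Rightarrow> real \<Rightarrow> 'w \<Rightarrow> real" where
  "set_proceeds S pol u \<Delta> x \<omega> =
     sum_list (map proceeds (settled_by (u + \<Delta>) (execution S (pol \<omega>) x \<omega>)))"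

text \<open>The envelopes are extended reals, so no boundedness is presupposed.\<close>

definition lower_proceeds ::
    "('w, 'p) position \<Rightarrow> ('w \<Rightarrow> 'p) \<Rightarrow> real \<Rightarrow> real \<Rightarrow> 'w set \<Rightarrow> real \<Rightarrow> ereal" where
  "lower_proceeds S pol u \<Delta> U x = (INF \<omega>\<in>U. ereal (set_proceeds S pol u \<Delta> x \<omega>))"

definition upper_debt_service ::
    "('w, 'p) position \<Rightarrow> real \<Rightarrow> real \<Rightarrow> 'w set \<Rightarrow> ereal" where
  "upper_debt_service S u \<Delta> U = (SUP \<omega>\<in>U. ereal (debt_service S (u + \<Delta>) \<omega>))"

definition feasible_caps ::
    "('w, 'p) position \<Rightarrow> ('w \<Rightarrow> 'p) \<Rightarrow> real \<Rightarrow> real \<Rightarrow> 'w set \<Rightarrow> real set" where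
  "feasible_caps S pol u \<Delta> U =
     {x \<in> grid S. ereal (cash0 S) + lower_proceeds S pol u \<Delta> U x
                    \<ge> upper_debt_service S u \<Delta> U + ereal (buffer S)}"

definition planned_cap ::
    "('w, 'p) position \<Rightarrow> ('w \<Rightarrow> 'p) \<Rightarrow> real \<Rightarrow> real \<Rightarrow> 'w set \<Rightarrow> real" where
  "planned_cap S pol u \<Delta> U = Min (feasible_caps S pol u \<Delta> U)"


subsection \<open>Standing assumptions\<close>

definition setting ::
    "'w measure \<Rightarrow> (real \<Rightarrow> 'w measure) \<Rightarrow> 'p measure \<Rightarrow> ('w, 'p) position \<Rightarrow>
     ('w \<Rightarrow> 'p) \<Rightarrow> real \<Rightarrow> 'w set \<Rightarrow> bool" where
  "setting M F MP S pol u U \<longleftrightarrow>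
     prob_space M \<and> filtration (space M) F \<and> (\<forall>t. sets (F t) \<subseteq> sets M) \<and>
     pol \<in> measurable (F u) MP \<and> U \<subseteq> space M \<and>
     0 \<le> cash0 S \<and> 0 < debt0 S \<and> 0 \<le> buffer S \<and>
     finite (grid S) \<and> 0 \<in> grid S \<and> grid S \<subseteq> {0..token_qty S} \<and>
     (\<forall>\<omega>\<in>space M. (\<forall>x\<in>grid S. valid_run u x (execution S (pol \<omega>) x \<omega>)) \<and>
                    debt_dynamics S u \<omega>)"


subsection \<open>Debt-first application\<close>

text \<open>
  State: cumulative payments \<open>a\<close> and cash \<open>k\<close> retained from receipts after payments. \<open>d a t\<close> is the
  debt met at \<open>t\<close>, \<open>out t\<close> the cash that has left the account other than to the loan, so
  \<open>k - out t\<close> is the dedicated cash actually present. Entries are pairs of time and increment.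
\<close>

fun apply_debt_first ::
    "(real \<Rightarrow> real \<Rightarrow> real) \<Rightarrow> (real \<Rightarrow> real) \<Rightarrow> real \<times> real \<Rightarrow> (real \<times> real) list \<Rightarrow> real \<times> real" where
  "apply_debt_first d out (a, k) [] = (a, k)"
| "apply_debt_first d out (a, k) ((t, b) # es) =
     (let p = min (d a t) (k - out t + b)
      in apply_debt_first d out (a + p, k + b - p) es)"

text \<open>
  The first entry puts the cash held at \<open>u\<close> through the rule, with increment 0. If it is
  simultaneous with a fill this changes nothing; it matters when no sale is needed (cap 0), where
  otherwise no increment would ever trigger a payment out of the cash already held.
\<close>

definition ledger :: "('w, 'p) position \<Rightarrow> real \<Rightarrow> real \<Rightarrow> 'w \<Rightarrow> real \<times> real" where
  "ledger S u t \<omega> =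
     apply_debt_first (\<lambda>a s. debt_owed S u a s \<omega>) (\<lambda>s. cash_removed S s \<omega> + released S s \<omega>)
       (0, cash0 S)
       (if first_applied S \<omega> \<le> t
        then (first_applied S \<omega>, 0) #
             map (\<lambda>f. (settle_time f, proceeds f)) (nths (live S \<omega>) {i. credited S i t \<omega>})
        else [])"

text \<open>
  Confirmed dedicated cash left after debt repayment. Cash handed to the borrower once the loan is
  extinct is not deducted.
\<close>

definition remaining_cash :: "('w, 'p) position \<Rightarrow> real \<Rightarrow> real \<Rightarrow> 'w \<Rightarrow> real" where
  "remaining_cash S u t \<omega> = snd (ledger S u t \<omega>)"


subsection \<open>Named conditions on a path\<close>

definition market_close :: "('w, 'p) position \<Rightarrow> real \<Rightarrow> 'w \<Rightarrow> ereal" where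
  "market_close S u \<omega> = (INF t\<in>{t. u \<le> t \<and> \<not> accepts S t \<omega>}. ereal t)"

definition execution_authority :: "('w, 'p) position \<Rightarrow> real \<Rightarrow> real \<Rightarrow> 'w \<Rightarrow> bool" where
  "execution_authority S u \<Delta> \<omega> \<longleftrightarrow>
     (\<forall>t\<in>{u..u + \<Delta>}. 0 < debt S t \<omega> \<longrightarrow> (\<forall>a. may S a t \<omega>))"

definition collateral_non_escape :: "('w, 'p) position \<Rightarrow> real \<Rightarrow> real \<Rightarrow> 'w \<Rightarrow> bool" where
  "collateral_non_escape S u \<Delta> \<omega> \<longleftrightarrow>
     (\<forall>t\<in>{u..u + \<Delta>}. (\<forall>s\<in>{u..<t}. 0 < debt S s \<omega>) \<longrightarrow>
        tokens_removed S t \<omega> = 0 \<and> cash_removed S t \<omega> = 0)"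

definition loan_priority :: "('w, 'p) position \<Rightarrow> real \<Rightarrow> real \<Rightarrow> 'w \<Rightarrow> bool" where
  "loan_priority S u \<Delta> \<omega> \<longleftrightarrow>
     (\<forall>t\<in>{u..u + \<Delta>}. (\<forall>s\<in>{u..<t}. 0 < debt S s \<omega>) \<longrightarrow> released S t \<omega> = 0)"

definition settlement_observability_finality ::
    "('w, 'p) position \<Rightarrow> real \<Rightarrow> real \<Rightarrow> 'w \<Rightarrow> bool" where
  "settlement_observability_finality S u \<Delta> \<omega> \<longleftrightarrow>
     (\<forall>i<length (live S \<omega>). \<forall>t\<in>{u..u + \<Delta>}.
        (settle_time (live S \<omega> ! i) \<le> t \<longrightarrow> credited S i t \<omega>) \<and>
        (credited S i t \<omega> \<longrightarrow> settle_time (live S \<omega> ! i) \<le> t) \<and>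
        (\<forall>t'\<in>{t..u + \<Delta>}. credited S i t \<omega> \<longrightarrow> credited S i t' \<omega>))"


subsection \<open>Behaviour of the policy\<close>

definition settled_qty :: "('w, 'p) position \<Rightarrow> real \<Rightarrow> 'w \<Rightarrow> real" where
  "settled_qty S t \<omega> = sum_list (map fill_qty (settled_by t (live S \<omega>)))"

definition can_act :: "('w, 'p) position \<Rightarrow> real \<Rightarrow> real \<Rightarrow> 'w \<Rightarrow> bool" where
  "can_act S u t \<omega> \<longleftrightarrow>
     accepts S t \<omega> \<and>
     (0 < debt S t \<omega> \<longrightarrow> (\<forall>a. may S a t \<omega>)) \<and>
     ((\<forall>s\<in>{u..<t}. 0 < debt S s \<omega>) \<longrightarrow> tokens_removed S t \<omega> = 0)"

text \<open>
  A policy that continues until a goal is met or the cap \<open>x\<close> has settled does so within the horizon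
  unless the controller is prevented from acting at some time (market closed, no authority, tokens
  gone). Without the proviso the condition would only be stronger.
\<close>

definition continues_until ::
    "('w, 'p) position \<Rightarrow> real \<Rightarrow> real \<Rightarrow> real \<Rightarrow> 'w \<Rightarrow> (real \<Rightarrow> bool) \<Rightarrow> bool" where
  "continues_until S u \<Delta> x \<omega> goal \<longleftrightarrow>
     (\<forall>t\<in>{u..u + \<Delta>}. can_act S u t \<omega>) \<longrightarrow>
     (\<exists>t\<in>{first_applied S \<omega>..u + \<Delta>}. goal t \<or> settled_qty S t \<omega> = x)"

definition completion_time ::
    "('w, 'p) position \<Rightarrow> real \<Rightarrow> real \<Rightarrow> real \<Rightarrow> 'w \<Rightarrow> (real \<Rightarrow> bool) \<Rightarrow> real \<Rightarrow> bool" where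
  "completion_time S u \<Delta> x \<omega> goal \<sigma> \<longleftrightarrow>
     \<sigma> \<in> {first_applied S \<omega>..u + \<Delta>} \<and> (goal \<sigma> \<or> settled_qty S \<sigma> \<omega> = x) \<and>
     (\<forall>t\<in>{first_applied S \<omega>..<\<sigma>}. \<not> (goal t \<or> settled_qty S t \<omega> = x))"

text \<open>
  The conditions on the live run against the cap \<open>x\<close>, apart from the stopping rule. The live run is a
  confirmed prefix of the full run, and every payment follows the debt-first rule.
\<close>

definition debt_first_execution ::
    "('w, 'p) position \<Rightarrow> ('w \<Rightarrow> 'p) \<Rightarrow> real \<Rightarrow> real \<Rightarrow> real \<Rightarrow> 'w \<Rightarrow> bool" where
  "debt_first_execution S pol u \<Delta> x \<omega> \<longleftrightarrow>
     prefix (live S \<omega>) (execution S (pol \<omega>) x \<omega>) \<and>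
     (\<forall>f\<in>set (live S \<omega>). settle_time f \<le> u + \<Delta>) \<and>
     first_applied S \<omega> \<in> {u..u + \<Delta>} \<and>
     (\<forall>f\<in>set (live S \<omega>). first_applied S \<omega> \<le> settle_time f) \<and>
     (\<forall>t\<in>{u..u + \<Delta>}. paid S t \<omega> = fst (ledger S u t \<omega>))"

definition covers_debt_and_buffer :: "('w, 'p) position \<Rightarrow> real \<Rightarrow> 'w \<Rightarrow> real \<Rightarrow> bool" where
  "covers_debt_and_buffer S u \<omega> t \<longleftrightarrow>
     remaining_cash S u t \<omega> \<ge> debt S t \<omega> + buffer S"

text \<open>
  \<open>D\<close> at \<open>\<sigma>\<^sup>+\<close> is zero: the balance just after the payments at \<open>\<sigma>\<close> and the right limit both vanish.
\<close>

definition debt_cleared_at :: "('w, 'p) position \<Rightarrow> 'w \<Rightarrow> real \<Rightarrow> bool" where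
  "debt_cleared_at S \<omega> \<sigma> \<longleftrightarrow>
     debt S \<sigma> \<omega> = 0 \<and> ((\<lambda>t. debt S t \<omega>) \<longlongrightarrow> 0) (at_right \<sigma>)"

end

theory Submission
  imports Defs
begin

text \<open>
  Between two consecutive ledger entries the payments are constant and the accrued debt does not
  decrease, so the loan can only become extinct at an entry. As long as it is not extinct no cash has
  left the account, so after each application of the debt-first rule either the debt is cleared or
  the retained cash is zero. Hence retained cash that covers the outstanding debt forces that debt to
  be zero. Cash is conserved: payments plus retained cash equal initial cash plus receipts.
  Therefore, once the full cap has settled, feasibility of the cap at the end of the horizon says
  exactly that the retained cash covers debt plus buffer, and this carries back to the last entry.
\<close>

section \<open>The debt-first rule\<close>

lemma apply_debt_first_append:
  "apply_debt_first d out st (xs @ ys) = apply_debt_first d out (apply_debt_first d out st xs) ys"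
proof (induction xs arbitrary: st)
  case Nil
  then show ?case by (cases st) simp
next
  case (Cons e xs)
  then show ?case by (cases st; cases e) (simp add: Let_def)
qed

text \<open>Each application moves \<open>p\<close> from cash to payments, so their sum changes only
  by the increment, whatever \<open>d\<close> and \<open>out\<close> are.\<close>

lemma apply_debt_first_conserves:
  "fst (apply_debt_first d out st es) + snd (apply_debt_first d out st es) =
     fst st + snd st + sum_list (map snd es)"
proof (induction es arbitrary: st)
  case Nil
  then show ?case by (cases st) simp
next
  case (Cons e es)
  then show ?case by (cases st; cases e) (simp add: Let_def)
qed

text \<open>Turns the selection of credited fills by index into a selection by settlement
  time.\<close>

lemma nths_eq_filter:
  assumes "\<And>i. i < length xs \<Longrightarrow> i \<in> I \<longleftrightarrow> P (xs ! i)"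
  shows "nths xs I = filter P xs"
  using assms
proof (induction xs arbitrary: I)
  case Nil
  then show ?case by simp
next
  case (Cons x xs)
  have "nths xs {j. Suc j \<in> I} = filter P xs"
    using Cons.prems by (intro Cons.IH) fastforce
  moreover have "0 \<in> I \<longleftrightarrow> P x"
    using Cons.prems[of 0] by simp
  ultimately show ?case by (simp add: nths_Cons)
qed

lemma extinct_before_mono:
  assumes "extinct_before S u s \<omega>" "s \<le> t"
  shows "extinct_before S u t \<omega>"
  using assms unfolding extinct_before_def by fastforce

lemma debt_owed_nonneg: "0 \<le> debt_owed S u a t \<omega>"
  by (simp add: debt_owed_def)

lemma debt_owed_eq_0_iff:
  "debt_owed S u a t \<omega> = 0 \<longleftrightarrow> extinct_before S u t \<omega> \<or> accrued_debt S u t \<omega> \<le> a"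
  by (auto simp: debt_owed_def)


section \<open>One path under the debt-first rule\<close>

text \<open>\<open>es\<close> lists all entries of the path, the first application of the cash
  included, so the ledger at \<open>t\<close> is one run over the entries no later than
  \<open>t\<close>. \<open>debt_eq\<close> reaches beyond \<open>T\<close> because the right limit
  of the debt at \<open>T\<close> looks past the horizon.\<close>

locale debt_first_path =
  fixes S :: "('w, 'p) position" and u T :: real and \<omega> :: 'w and es :: "(real \<times> real) list"
  assumes sorted_entries: "sorted (map fst es)"
    and entry_ge: "e \<in> set es \<Longrightarrow> u \<le> fst e"
    and accrued_mono: "u \<le> s \<Longrightarrow> s \<le> t \<Longrightarrow> accrued_debt S u s \<omega> \<le> accrued_debt S u t \<omega>"
    and accrued_pos: "0 < accrued_debt S u u \<omega>"
    and ledger_eq: "t \<in> {u..T} \<Longrightarrow> ledger S u t \<omega> =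
       apply_debt_first (\<lambda>a s. debt_owed S u a s \<omega>) (\<lambda>s. cash_removed S s \<omega> + released S s \<omega>)
         (0, cash0 S) (filter (\<lambda>e. fst e \<le> t) es)"
    and paid_eq: "t \<in> {u..T} \<Longrightarrow> paid S t \<omega> = fst (ledger S u t \<omega>)"
    and debt_eq: "u \<le> t \<Longrightarrow> debt S t \<omega> = debt_owed S u (paid S t \<omega>) t \<omega>"
    and no_outflow: "t \<in> {u..T} \<Longrightarrow> \<not> extinct_before S u t \<omega> \<Longrightarrow>
       cash_removed S t \<omega> + released S t \<omega> = 0"
begin

lemma debt_nonneg: "u \<le> t \<Longrightarrow> 0 \<le> debt S t \<omega>"
  by (simp add: debt_eq debt_owed_nonneg)

lemma debt_eq_0_iff:
  "u \<le> t \<Longrightarrow> debt S t \<omega> = 0 \<longleftrightarrow> extinct_before S u t \<omega> \<or> accrued_debt S u t \<omega> \<le> paid S t \<omega>"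
  by (simp add: debt_eq debt_owed_eq_0_iff)

text \<open>Clearing is permanent: a zero balance at \<open>t\<close> makes
  \<open>extinct_before\<close> true at every later time, so the debt vanishes identically to the
  right of \<open>t\<close>.\<close>

lemma debt_cleared_atI:
  assumes "u \<le> t" "debt S t \<omega> = 0"
  shows "debt_cleared_at S \<omega> t"
proof -
  have "debt S s \<omega> = 0" if "t < s" for s
  proof -
    have "extinct_before S u s \<omega>"
      using assms that extinct_before_mono[of S u t \<omega> s]
      by (force simp: debt_eq_0_iff extinct_before_def)
    with assms that show ?thesis by (simp add: debt_eq_0_iff)
  qed
  then have "eventually (\<lambda>s. debt S s \<omega> = 0) (at_right t)"
    by (auto simp: eventually_at_filter)
  with assms(2) show ?thesis
    by (auto simp: debt_cleared_at_def intro: tendsto_eventually)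
qed

text \<open>Conservation of cash. It survives extinction, since \<open>remaining_cash\<close> never
  deducts what is handed to the borrower.\<close>

lemma payments_plus_cash:
  assumes "t \<in> {u..T}"
  shows "paid S t \<omega> + remaining_cash S u t \<omega> =
    cash0 S + sum_list (map snd (filter (\<lambda>e. fst e \<le> t) es))"
  using assms by (simp add: paid_eq remaining_cash_def ledger_eq apply_debt_first_conserves)

text \<open>Moves a time back to the last entry \<open>s\<close> at or before it. Equality of the
  filters says that entries simultaneous with \<open>s\<close> are all included and that none
  follows up to \<open>t\<close>.\<close>

lemma last_entry:
  assumes "\<exists>e\<in>set es. fst e \<le> t"
  obtains ys s b where "filter (\<lambda>e. fst e \<le> t) es = ys @ [(s, b)]" "(s, b) \<in> set es"
    "u \<le> s" "s \<le> t" "filter (\<lambda>e. fst e \<le> s) es = filter (\<lambda>e. fst e \<le> t) es"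
proof -
  have "filter (\<lambda>e. fst e \<le> t) es \<noteq> []"
    using assms by (auto simp: filter_empty_conv)
  then obtain ys s b where ys: "filter (\<lambda>e. fst e \<le> t) es = ys @ [(s, b)]"
    by (metis rev_exhaust surj_pair)
  then have "(s, b) \<in> set (filter (\<lambda>e. fst e \<le> t) es)" by simp
  then have sb: "(s, b) \<in> set es" "s \<le> t" by auto
  have "sorted (map fst (filter (\<lambda>e. fst e \<le> t) es))"
    using sorted_entries by (rule sorted_filter)
  then have "\<forall>e\<in>set (filter (\<lambda>e. fst e \<le> t) es). fst e \<le> s"
    unfolding ys by (auto simp: sorted_append)
  then have "filter (\<lambda>e. fst e \<le> s) es = filter (\<lambda>e. fst e \<le> t) es"
    using sb(2) by (intro filter_cong) auto
  with that ys sb entry_ge[OF sb(1)] show ?thesis by simp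
qed

text \<open>Equal filters mean equal ledgers, so between \<open>s\<close> and \<open>t\<close> the
  balance can change only by accrual, which does not lower it.\<close>

lemma constant_without_entries:
  assumes "u \<le> s" "s \<le> t" "t \<le> T"
    and same: "filter (\<lambda>e. fst e \<le> s) es = filter (\<lambda>e. fst e \<le> t) es"
  shows "paid S s \<omega> = paid S t \<omega>"
    and "remaining_cash S u s \<omega> = remaining_cash S u t \<omega>"
    and "debt S s \<omega> \<le> debt S t \<omega>"
proof -
  have paid_const: "paid S r \<omega> = paid S s \<omega>" if "r \<in> {s..t}" for r
  proof -
    \<comment> \<open>An entry by \<open>r\<close> is an entry by \<open>t\<close>, and those all
      lie at or before \<open>s\<close>.\<close>
    have "e \<in> set (filter (\<lambda>e. fst e \<le> s) es)" if "e \<in> set es" "fst e \<le> r" for e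
      unfolding same using that \<open>r \<in> {s..t}\<close> by auto
    then have "filter (\<lambda>e. fst e \<le> r) es = filter (\<lambda>e. fst e \<le> s) es"
      using that by (intro filter_cong) auto
    with that assms(1-3) show ?thesis by (simp add: paid_eq ledger_eq)
  qed
  show paid_st: "paid S s \<omega> = paid S t \<omega>"
    using paid_const[of t] assms(2) by simp
  show "remaining_cash S u s \<omega> = remaining_cash S u t \<omega>"
    using assms by (simp add: remaining_cash_def ledger_eq)
  have acc: "accrued_debt S u s \<omega> \<le> accrued_debt S u t \<omega>"
    using assms(1,2) by (rule accrued_mono)
  show "debt S s \<omega> \<le> debt S t \<omega>"
  proof (cases "extinct_before S u t \<omega>")
    case True
    then obtain r where r: "u \<le> r" "r < t" "accrued_debt S u r \<omega> \<le> paid S r \<omega>"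
      by (auto simp: extinct_before_def)
    have "debt S s \<omega> = 0"
    proof (cases "r < s")
      case True
      with r have "extinct_before S u s \<omega>" by (auto simp: extinct_before_def)
      with assms(1) show ?thesis by (simp add: debt_eq_0_iff)
    next
      \<comment> \<open>Extinction at some \<open>r\<close> at or after \<open>s\<close> is already
        present at \<open>s\<close>: payments are frozen there and the accrued debt at
        \<open>s\<close> is no larger.\<close>
      case False
      then have "accrued_debt S u s \<omega> \<le> accrued_debt S u r \<omega>" "paid S r \<omega> = paid S s \<omega>"
        using accrued_mono[OF assms(1), of r] paid_const[of r] r(2) by simp_all
      with r(3) assms(1) show ?thesis by (simp add: debt_eq_0_iff)
    qed
    with assms(1,2) show ?thesis by (simp add: debt_nonneg)
  next
    case False
    then have "\<not> extinct_before S u s \<omega>"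
      using extinct_before_mono[OF _ assms(2)] by metis
    with False acc paid_st show ?thesis
      using assms(1,2) by (simp add: debt_eq debt_owed_def max.coboundedI2)
  qed
qed

text \<open>While the loan lives no cash has left the account, so the last application pays the
  minimum of the balance and the cash on hand. The rest is nonnegative, and positive only if the
  balance was paid in full.\<close>

lemma cash_after_entry:
  assumes t: "t \<in> {u..T}" and entry: "\<exists>e\<in>set es. fst e \<le> t"
    and alive: "\<not> extinct_before S u t \<omega>"
  shows "0 \<le> remaining_cash S u t \<omega>"
    and "remaining_cash S u t \<omega> = 0 \<or> debt S t \<omega> = 0"
proof -
  let ?d = "\<lambda>a s. debt_owed S u a s \<omega>"
  let ?out = "\<lambda>s. cash_removed S s \<omega> + released S s \<omega>"
  obtain ys s b where s: "filter (\<lambda>e. fst e \<le> t) es = ys @ [(s, b)]" "u \<le> s" "s \<le> t"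
      "filter (\<lambda>e. fst e \<le> s) es = filter (\<lambda>e. fst e \<le> t) es"
    using last_entry[OF entry] by metis
  obtain a k where ak: "apply_debt_first ?d ?out (0, cash0 S) ys = (a, k)"
    by fastforce
  have alive_s: "\<not> extinct_before S u s \<omega>"
    using alive extinct_before_mono[OF _ s(3)] by metis
  define p where "p = min (?d a s) (k + b)"
  have out: "cash_removed S s \<omega> + released S s \<omega> = 0"
    using no_outflow alive_s s t by simp
  have led: "ledger S u t \<omega> = (a + p, k + b - p)"
    using t out by (simp add: ledger_eq s(1) apply_debt_first_append ak p_def Let_def)
  then have rem: "remaining_cash S u t \<omega> = k + b - p"
    by (simp add: remaining_cash_def)
  then show "0 \<le> remaining_cash S u t \<omega>"
    by (simp add: p_def)
  show "remaining_cash S u t \<omega> = 0 \<or> debt S t \<omega> = 0"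
  proof (cases "p = k + b")
    case True
    with rem show ?thesis by simp
  next
    case False
    then have "p = ?d a s" by (simp add: p_def min_def split: if_splits)
    then have "accrued_debt S u s \<omega> \<le> a + p"
      using alive_s by (simp add: debt_owed_def)
    also have "\<dots> = paid S t \<omega>"
      using t led by (simp add: paid_eq)
    also have "\<dots> = paid S s \<omega>"
      using constant_without_entries(1)[OF s(2,3) _ s(4)] t by simp
    finally have cleared: "accrued_debt S u s \<omega> \<le> paid S s \<omega>" .
    \<comment> \<open>Clearing at an earlier \<open>s\<close> would witness extinction before
      \<open>t\<close>, so the last entry is at \<open>t\<close> itself.\<close>
    then have "\<not> s < t"
      using alive s by (auto simp: extinct_before_def)
    with s cleared show ?thesis by (auto simp: debt_eq_0_iff)
  qed
qed

lemma covered_debt_is_0: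
  assumes "t \<in> {u..T}" "\<exists>e\<in>set es. fst e \<le> t" "debt S t \<omega> \<le> remaining_cash S u t \<omega>"
  shows "debt S t \<omega> = 0"
proof (cases "extinct_before S u t \<omega>")
  case True
  with assms show ?thesis by (simp add: debt_eq_0_iff)
next
  case False
  with assms cash_after_entry(2)[of t] debt_nonneg[of t] show ?thesis by auto
qed

text \<open>A property that carries back to the last preceding entry has an earliest time, because
  only the finitely many entry times compete.\<close>

lemma first_time_is_entry:
  assumes t: "t \<in> {u..T}" "\<exists>e\<in>set es. fst e \<le> t" "P t"
    and stable: "\<And>s r. s \<in> fst ` set es \<Longrightarrow> u \<le> s \<Longrightarrow> s \<le> r \<Longrightarrow> r \<le> T \<Longrightarrow>
      filter (\<lambda>e. fst e \<le> s) es = filter (\<lambda>e. fst e \<le> r) es \<Longrightarrow> P r \<Longrightarrow> P s"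
  obtains \<sigma> where "\<sigma> \<in> fst ` set es" "\<sigma> \<in> {u..t}" "P \<sigma>"
    "\<And>s. s < \<sigma> \<Longrightarrow> \<exists>e\<in>set es. fst e \<le> s \<Longrightarrow> \<not> P s"
proof -
  let ?E = "{s \<in> fst ` set es. s \<le> t \<and> P s}"
  \<comment> \<open>Any time with \<open>P\<close> is preceded by an entry time with
    \<open>P\<close>, so the minimum over entries bounds all times from below.\<close>
  have earlier: "\<exists>s\<in>?E. s \<le> r" if r: "r \<le> t" "\<exists>e\<in>set es. fst e \<le> r" "P r" for r
  proof -
    obtain s b where "(s, b) \<in> set es" "u \<le> s" "s \<le> r"
        "filter (\<lambda>e. fst e \<le> s) es = filter (\<lambda>e. fst e \<le> r) es"
      using last_entry[OF r(2)] by metis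
    moreover from this(1) have "s \<in> fst ` set es" by force
    ultimately show ?thesis
      using stable[of s r] r t(1) by (intro bexI[of _ s]) auto
  qed
  have fin: "finite ?E" and "?E \<noteq> {}" using earlier[of t] t by auto
  then have min: "Min ?E \<in> ?E" by (rule Min_in)
  show ?thesis
  proof (rule that)
    show "Min ?E \<in> fst ` set es" "P (Min ?E)" using min by auto
    show "Min ?E \<in> {u..t}" using min entry_ge by auto
    show "\<not> P s" if s: "s < Min ?E" "\<exists>e\<in>set es. fst e \<le> s" for s
    proof
      assume "P s"
      moreover have "s \<le> t" using s(1) min by auto
      ultimately obtain s' where "s' \<in> ?E" "s' \<le> s" using earlier s(2) by blast
      with Min_le[OF fin, of s'] s(1) show False by linarith
    qed
  qed
qed

text \<open>\<open>cash_after_entry\<close> controls the cash only while the loan is alive. Hence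
  \<open>\<sigma>\<close> is the first time at which payments reach the accrued debt, which may be
  earlier than \<open>t\<close>.\<close>

lemma extinction_leaves_nonneg_cash:
  assumes t: "t \<in> {u..T}" and "debt S t \<omega> = 0"
  obtains \<sigma> where "\<sigma> \<in> {u..t}" "debt S \<sigma> \<omega> = 0" "0 \<le> remaining_cash S u \<sigma> \<omega>"
proof -
  let ?P = "\<lambda>t. accrued_debt S u t \<omega> \<le> paid S t \<omega>"
  \<comment> \<open>With no entry nothing has been paid, while the accrued debt is at least its
    positive initial value.\<close>
  have has_entry: "\<exists>e\<in>set es. fst e \<le> s" if "s \<in> {u..T}" "?P s" for s
  proof (rule ccontr)
    assume "\<not> (\<exists>e\<in>set es. fst e \<le> s)"
    then have "filter (\<lambda>e. fst e \<le> s) es = []" by (auto simp: filter_empty_conv)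
    then have "paid S s \<omega> = 0" using that by (simp add: paid_eq ledger_eq)
    moreover have "accrued_debt S u u \<omega> \<le> accrued_debt S u s \<omega>"
      using that by (simp add: accrued_mono)
    ultimately show False using that accrued_pos by simp
  qed
  obtain s where s: "s \<in> {u..t}" "?P s"
    using assms by (force simp: debt_eq_0_iff extinct_before_def)
  then have sT: "s \<in> {u..T}" using t by simp
  have stable: "?P r" if "u \<le> r" "r \<le> r'" "r' \<le> T"
      "filter (\<lambda>e. fst e \<le> r) es = filter (\<lambda>e. fst e \<le> r') es" "?P r'" for r r'
    using constant_without_entries(1)[OF that(1-4)] accrued_mono[OF that(1,2)] that(5) by simp
  obtain \<sigma> where \<sigma>: "\<sigma> \<in> fst ` set es" "\<sigma> \<in> {u..s}" "?P \<sigma>"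
      "\<And>r. r < \<sigma> \<Longrightarrow> \<exists>e\<in>set es. fst e \<le> r \<Longrightarrow> \<not> ?P r"
    using first_time_is_entry[where P = ?P, OF sT has_entry[OF sT s(2)] s(2)] stable by blast
  \<comment> \<open>\<open>extinct_before\<close> looks strictly before \<open>\<sigma>\<close>, so
    clearing at \<open>\<sigma>\<close> itself does not count.\<close>
  have "\<not> extinct_before S u \<sigma> \<omega>"
  proof
    assume "extinct_before S u \<sigma> \<omega>"
    then obtain r where r: "r \<in> {u..<\<sigma>}" "?P r" by (auto simp: extinct_before_def)
    then have "r \<in> {u..T}" using \<sigma>(2) sT by simp
    with has_entry r \<sigma>(4)[of r] show False by simp
  qed
  moreover have "\<exists>e\<in>set es. fst e \<le> \<sigma>" using \<sigma>(1) by auto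
  ultimately have "0 \<le> remaining_cash S u \<sigma> \<omega>"
    using cash_after_entry(1) \<sigma>(2) sT by simp
  with that[of \<sigma>] \<sigma> s show ?thesis by (simp add: debt_eq_0_iff)
qed

text \<open>Going back without crossing an entry leaves the cash unchanged and cannot raise the
  debt.\<close>

lemma covers_stable:
  assumes "u \<le> s" "s \<le> t" "t \<le> T"
    and "filter (\<lambda>e. fst e \<le> s) es = filter (\<lambda>e. fst e \<le> t) es"
    and "covers_debt_and_buffer S u \<omega> t"
  shows "covers_debt_and_buffer S u \<omega> s"
  using constant_without_entries[OF assms(1-4)] assms(5)
  by (simp add: covers_debt_and_buffer_def)

end


section \<open>Consequences of the standing assumptions\<close>

lemma accrued_debt_at_start:
  assumes "debt_dynamics S u \<omega>"
  shows "accrued_debt S u u \<omega> = debt0 S"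
proof -
  have "AE s in lborel. indicat_real {u..u} s *\<^sub>R (rate S s \<omega> * debt S s \<omega>) = 0"
    using AE_lborel_singleton[of u] by eventually_elim simp
  then have "(LBINT s:{u..u}. rate S s \<omega> * debt S s \<omega>) = 0"
    unfolding set_lebesgue_integral_def by (rule integral_eq_zero_AE)
  with assms show ?thesis by (simp add: accrued_debt_def debt_dynamics_def)
qed

text \<open>Interest is nonnegative because the balance is, which comes from the debt equation; that
  equation is available only while no principal is drawn.\<close>

lemma accrued_debt_mono:
  assumes dyn: "debt_dynamics S u \<omega>" and no_borrowing: "\<forall>t\<ge>u. borrowed S t \<omega> = 0"
    and "u \<le> s" "s \<le> t"
  shows "accrued_debt S u s \<omega> \<le> accrued_debt S u t \<omega>"
proof -
  let ?f = "\<lambda>s. rate S s \<omega> * debt S s \<omega>"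
  have nonneg: "0 \<le> ?f r" if "u \<le> r" for r
    using dyn no_borrowing that by (simp add: debt_dynamics_def debt_owed_nonneg)
  have "(LBINT r:{u..s}. ?f r) \<le> (LBINT r:{u..t}. ?f r)"
    unfolding set_lebesgue_integral_def
  proof (rule integral_mono)
    show "integrable lborel (\<lambda>r. indicat_real {u..s} r *\<^sub>R ?f r)"
      "integrable lborel (\<lambda>r. indicat_real {u..t} r *\<^sub>R ?f r)"
      using dyn assms(3,4) by (auto simp: debt_dynamics_def set_integrable_def)
    show "indicat_real {u..s} r *\<^sub>R ?f r \<le> indicat_real {u..t} r *\<^sub>R ?f r" for r
      using nonneg[of r] assms(3,4) by (auto simp: indicator_def)
  qed
  moreover have "charges S s \<omega> \<le> charges S t \<omega>"
    using dyn assms(3,4) by (auto simp: debt_dynamics_def mono_on_def)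
  ultimately show ?thesis by (simp add: accrued_debt_def)
qed

lemma market_open_before_close:
  assumes "market_close S u \<omega> > ereal T" "t \<in> {u..T}"
  shows "accepts S t \<omega>"
proof (rule ccontr)
  assume "\<not> accepts S t \<omega>"
  with assms(2) have "market_close S u \<omega> \<le> ereal t"
    unfolding market_close_def by (intro INF_lower) simp
  also have "\<dots> \<le> ereal T" using assms(2) by simp
  finally show False using assms(1) by simp
qed

text \<open>Specialises both envelopes to one path of the operating set. The two ends of the chain
  are finite, so the inequality descends to the reals.\<close>

lemma feasible_cap_covers:
  assumes "x \<in> feasible_caps S pol u \<Delta> U" "\<omega> \<in> U"
  shows "debt_service S (u + \<Delta>) \<omega> + buffer S \<le> cash0 S + set_proceeds S pol u \<Delta> x \<omega>"
proof -
  have "ereal (debt_service S (u + \<Delta>) \<omega>) + ereal (buffer S)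
      \<le> upper_debt_service S u \<Delta> U + ereal (buffer S)"
    unfolding upper_debt_service_def using assms(2) by (intro add_right_mono SUP_upper)
  also have "\<dots> \<le> ereal (cash0 S) + lower_proceeds S pol u \<Delta> U x"
    using assms(1) by (simp add: feasible_caps_def)
  also have "\<dots> \<le> ereal (cash0 S) + ereal (set_proceeds S pol u \<Delta> x \<omega>)"
    unfolding lower_proceeds_def using assms(2) by (intro add_left_mono INF_lower)
  finally show ?thesis by simp
qed

lemma sum_list_fill_qty_pos:
  assumes "\<forall>f\<in>set fs. 0 < fill_qty f" "fs \<noteq> []"
  shows "0 < sum_list (map fill_qty fs)"
  using assms
proof (induction fs)
  case (Cons f fs)
  then show ?case by (cases "fs = []") (auto intro: add_pos_pos)
qed simp

text \<open>Fill quantities are positive, so nothing can be left of the run once the whole cap has been sold.\<close>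

lemma prefix_settling_cap:
  assumes run: "valid_run u x fs" and pre: "prefix gs fs"
    and cap: "sum_list (map fill_qty (settled_by t gs)) = x"
  shows "gs = fs" "settled_by t gs = gs"
proof -
  obtain hs where hs: "fs = gs @ hs" using pre by (auto elim: prefixE)
  let ?late = "filter (\<lambda>f. \<not> settle_time f \<le> t) gs"
  have pos: "\<forall>f\<in>set fs. 0 < fill_qty f" using run by (simp add: valid_run_def)
  have split: "sum_list (map fill_qty gs) =
      sum_list (map fill_qty (settled_by t gs)) + sum_list (map fill_qty ?late)"
    unfolding settled_by_def by (induction gs) auto
  have "x + sum_list (map fill_qty ?late) + sum_list (map fill_qty hs) \<le> x"
    using run split cap by (simp add: valid_run_def hs)
  moreover have "0 \<le> sum_list (map fill_qty ?late)" "0 \<le> sum_list (map fill_qty hs)"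
    using pos by (auto simp: hs less_imp_le intro!: sum_list_nonneg)
  ultimately have "sum_list (map fill_qty ?late) = 0" "sum_list (map fill_qty hs) = 0"
    by linarith+
  moreover have "\<forall>f\<in>set ?late. 0 < fill_qty f" "\<forall>f\<in>set hs. 0 < fill_qty f"
    using pos by (auto simp: hs)
  ultimately have late: "?late = []" and "hs = []"
    using sum_list_fill_qty_pos[of ?late] sum_list_fill_qty_pos[of hs] by argo+
  then show "gs = fs" by (simp add: hs)
  show "settled_by t gs = gs"
    using late by (simp add: settled_by_def filter_id_conv filter_empty_conv)
qed


section \<open>The planned sale clears the debt\<close>

text \<open>The entries of the whole path, settled or not; truncation in time is left to a filter.
  The increment 0 lets cash held at the start count as an ordinary entry.\<close>

definition ledger_entries :: "('w, 'p) position \<Rightarrow> 'w \<Rightarrow> (real \<times> real) list" where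
  "ledger_entries S \<omega> =
     (first_applied S \<omega>, 0) # map (\<lambda>f. (settle_time f, proceeds f)) (live S \<omega>)"

text \<open>Finality makes being credited at \<open>t\<close> equivalent to having settled by
  \<open>t\<close>. Before the first application no fill has settled, so both lists are
  empty.\<close>

lemma ledger_eq_settled_entries:
  assumes fin: "settlement_observability_finality S u \<Delta> \<omega>" and t: "t \<in> {u..u + \<Delta>}"
    and first: "\<forall>f\<in>set (live S \<omega>). first_applied S \<omega> \<le> settle_time f"
  shows "ledger S u t \<omega> =
    apply_debt_first (\<lambda>a s. debt_owed S u a s \<omega>) (\<lambda>s. cash_removed S s \<omega> + released S s \<omega>)
      (0, cash0 S) (filter (\<lambda>e. fst e \<le> t) (ledger_entries S \<omega>))"
proof -
  have "i \<in> {i. credited S i t \<omega>} \<longleftrightarrow> settle_time (live S \<omega> ! i) \<le> t"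
    if "i < length (live S \<omega>)" for i
    using fin t that unfolding settlement_observability_finality_def by blast
  then have credited: "nths (live S \<omega>) {i. credited S i t \<omega>} = settled_by t (live S \<omega>)"
    unfolding settled_by_def by (rule nths_eq_filter)
  have late: "settled_by t (live S \<omega>) = []" if "\<not> first_applied S \<omega> \<le> t"
    using first that by (fastforce simp: settled_by_def filter_empty_conv)
  have "filter (\<lambda>e. fst e \<le> t) (ledger_entries S \<omega>) =
      (if first_applied S \<omega> \<le> t
       then (first_applied S \<omega>, 0) #
         map (\<lambda>f. (settle_time f, proceeds f)) (settled_by t (live S \<omega>)) else [])"
    using late by (simp add: ledger_entries_def settled_by_def filter_map o_def)
  then show ?thesis unfolding ledger_def credited by (rule ssubst) (rule refl)
qed

theorem theorem6p1:
  fixes M :: "'w measure" and F :: "real \<Rightarrow> 'w measure" and MP :: "'p measure"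
    and S :: "('w, 'p) position" and pol :: "'w \<Rightarrow> 'p"
    and u \<Delta> x_hat :: real and U :: "'w set" and \<omega> :: 'w
  defines "x_hat \<equiv> planned_cap S pol u \<Delta> U"
  assumes setting: "setting M F MP S pol u U"
    and horizon: "0 < \<Delta>"
    and planned: "feasible_caps S pol u \<Delta> U \<noteq> {}"
    and operating: "\<omega> \<in> U"
    and close: "market_close S u \<omega> > ereal (u + \<Delta>)"
    and authority: "execution_authority S u \<Delta> \<omega>"
    and custody: "collateral_non_escape S u \<Delta> \<omega>"
    and priority: "loan_priority S u \<Delta> \<omega>"
    and finality: "settlement_observability_finality S u \<Delta> \<omega>"
    and policy: "debt_first_execution S pol u \<Delta> x_hat \<omega>"
    and continues: "continues_until S u \<Delta> x_hat \<omega> (\<lambda>t. debt S t \<omega> = 0)"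
    and no_borrowing: "\<forall>t\<ge>u. borrowed S t \<omega> = 0"
  shows "(\<exists>\<sigma>\<in>{u..u + \<Delta>}. debt_cleared_at S \<omega> \<sigma> \<and> remaining_cash S u \<sigma> \<omega> \<ge> 0) \<and>
    (continues_until S u \<Delta> x_hat \<omega> (covers_debt_and_buffer S u \<omega>) \<longrightarrow>
      (\<exists>\<sigma>\<in>{u..u + \<Delta>}. completion_time S u \<Delta> x_hat \<omega> (covers_debt_and_buffer S u \<omega>) \<sigma> \<and>
        debt_cleared_at S \<omega> \<sigma> \<and> remaining_cash S u \<sigma> \<omega> \<ge> buffer S)) \<and>
    (settled_qty S (u + \<Delta>) \<omega> = x_hat \<longrightarrow>
      (\<exists>\<sigma>\<in>{u..u + \<Delta>}. completion_time S u \<Delta> x_hat \<omega> (\<lambda>_. False) \<sigma> \<and>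
        debt_cleared_at S \<omega> \<sigma> \<and> remaining_cash S u \<sigma> \<omega> \<ge> buffer S))"
proof -
  let ?T = "u + \<Delta>" and ?es = "ledger_entries S \<omega>" and ?covers = "covers_debt_and_buffer S u \<omega>"
  have "finite (feasible_caps S pol u \<Delta> U)"
    using setting by (simp add: setting_def feasible_caps_def)
  then have x_feasible: "x_hat \<in> feasible_caps S pol u \<Delta> U"
    using planned unfolding x_hat_def planned_cap_def by (rule Min_in)
  then have "x_hat \<in> grid S" by (simp add: feasible_caps_def)
  moreover have "\<omega> \<in> space M" using setting operating by (auto simp: setting_def)
  ultimately have run: "valid_run u x_hat (execution S (pol \<omega>) x_hat \<omega>)"
    and dyn: "debt_dynamics S u \<omega>"
    using setting by (auto simp: setting_def)
  have buffer: "0 \<le> buffer S" and debt0: "0 < debt0 S"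
    using setting by (auto simp: setting_def)
  have pre: "prefix (live S \<omega>) (execution S (pol \<omega>) x_hat \<omega>)"
    and settles: "\<forall>f\<in>set (live S \<omega>). settle_time f \<le> ?T"
    and first: "first_applied S \<omega> \<in> {u..?T}"
    and first_le: "\<forall>f\<in>set (live S \<omega>). first_applied S \<omega> \<le> settle_time f"
    and paid: "\<forall>t\<in>{u..?T}. paid S t \<omega> = fst (ledger S u t \<omega>)"
    using policy by (auto simp: debt_first_execution_def)
  have debt: "debt S t \<omega> = debt_owed S u (paid S t \<omega>) t \<omega>" if "u \<le> t" for t
    using dyn no_borrowing that by (simp add: debt_dynamics_def)
  interpret debt_first_path S u ?T \<omega> ?es
  proof
    have "sorted (map settle_time (live S \<omega>))"
      using run pre by (auto simp: valid_run_def sorted_append elim!: prefixE)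
    then show "sorted (map fst ?es)"
      using first_le by (auto simp: ledger_entries_def o_def)
    show "u \<le> fst e" if "e \<in> set ?es" for e
      using that first first_le by (force simp: ledger_entries_def)
    show "0 < accrued_debt S u u \<omega>"
      using accrued_debt_at_start[OF dyn] debt0 by simp
    \<comment> \<open>Custody and priority are conditioned on positive debt before \<open>t\<close>;
      this follows from non-extinction, as the accrued debt then exceeds payments at every earlier
      time.\<close>
    show "cash_removed S t \<omega> + released S t \<omega> = 0"
      if t: "t \<in> {u..?T}" "\<not> extinct_before S u t \<omega>" for t
    proof -
      have "0 < debt S s \<omega>" if "s \<in> {u..<t}" for s
      proof -
        have "\<not> extinct_before S u s \<omega>"
          using t(2) that extinct_before_mono[of S u s \<omega> t] by auto
        moreover have "0 < accrued_debt S u s \<omega> - paid S s \<omega>"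
          using t(2) that by (force simp: extinct_before_def not_le)
        ultimately show ?thesis
          using that by (simp add: debt debt_owed_def)
      qed
      with t(1) custody priority show ?thesis
        by (simp add: collateral_non_escape_def loan_priority_def)
    qed
  qed (use paid debt accrued_debt_mono[OF dyn no_borrowing]
      ledger_eq_settled_entries[OF finality _ first_le] in auto)
  have entry: "(\<exists>e\<in>set ?es. fst e \<le> t) \<longleftrightarrow> first_applied S \<omega> \<le> t" for t
    using first_le by (force simp: ledger_entries_def)
  \<comment> \<open>Discharges the proviso of \<open>continues_until\<close>.\<close>
  have can_act: "\<forall>t\<in>{u..?T}. can_act S u t \<omega>"
    using market_open_before_close[OF close] authority custody
    by (auto simp: can_act_def execution_authority_def collateral_non_escape_def)
  have T: "?T \<in> {u..?T}" using horizon by simp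
  \<comment> \<open>If the full cap settles, the live run is the complete run, so its receipts are a
    value of the capacity curve. Conservation and feasibility, both taken at the end of the horizon,
    then leave cash for debt and buffer.\<close>
  have covers_at_end: "?covers ?T" and settled_entries: "filter (\<lambda>e. fst e \<le> t) ?es = ?es"
    if t: "t \<in> {first_applied S \<omega>..?T}" "settled_qty S t \<omega> = x_hat" for t
  proof -
    note full = prefix_settling_cap[OF run pre t(2)[unfolded settled_qty_def]]
    have "\<forall>f\<in>set (live S \<omega>). settle_time f \<le> t"
      using full(2) by (simp add: settled_by_def filter_id_conv)
    then show all: "filter (\<lambda>e. fst e \<le> t) ?es = ?es"
      using t(1) by (auto simp: ledger_entries_def filter_id_conv)
    have "filter (\<lambda>e. fst e \<le> ?T) ?es = ?es"
      using settles first by (auto simp: ledger_entries_def filter_id_conv)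
    moreover have "settled_by ?T (live S \<omega>) = live S \<omega>"
      using settles by (simp add: settled_by_def filter_id_conv)
    ultimately have "paid S ?T \<omega> + remaining_cash S u ?T \<omega> =
        cash0 S + set_proceeds S pol u \<Delta> x_hat \<omega>"
      using payments_plus_cash[OF T] full(1)
      by (simp add: set_proceeds_def ledger_entries_def o_def)
    with feasible_cap_covers[OF x_feasible operating] show "?covers ?T"
      by (simp add: covers_debt_and_buffer_def debt_service_def)
  qed
  \<comment> \<open>All entries have occurred by \<open>t\<close>, so coverage at the end carries
    back to \<open>t\<close>.\<close>
  have settled_covers: "?covers t"
    if t: "t \<in> {first_applied S \<omega>..?T}" "settled_qty S t \<omega> = x_hat" for t
  proof (rule covers_stable)
    show "?covers ?T" using covers_at_end t .
    show "filter (\<lambda>e. fst e \<le> t) ?es = filter (\<lambda>e. fst e \<le> ?T) ?es"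
      using settled_entries[OF t] t(1)
      by (metis (no_types, lifting) atLeastAtMost_iff filter_id_conv order_trans)
  qed (use t first in auto)
  have covers_clears: "debt_cleared_at S \<omega> t \<and> buffer S \<le> remaining_cash S u t \<omega>"
    if t: "t \<in> {first_applied S \<omega>..?T}" "?covers t" for t
  proof -
    have "debt S t \<omega> = 0"
      using t first buffer entry
      by (intro covered_debt_is_0) (auto simp: covers_debt_and_buffer_def)
    with t first show ?thesis
      by (auto simp: covers_debt_and_buffer_def intro: debt_cleared_atI)
  qed
  \<comment> \<open>Kept general in \<open>goal\<close> to serve both targets: coverage, and the
    constantly false goal, for which completion means settlement of the cap.\<close>
  have completion: "\<exists>\<sigma>\<in>{u..?T}. completion_time S u \<Delta> x_hat \<omega> goal \<sigma> \<and>
      debt_cleared_at S \<omega> \<sigma> \<and> remaining_cash S u \<sigma> \<omega> \<ge> buffer S"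
    if t: "t \<in> {first_applied S \<omega>..?T}" "goal t \<or> settled_qty S t \<omega> = x_hat"
      and goal_covers: "\<And>s. goal s \<Longrightarrow> ?covers s"
      and goal_stable: "\<And>s r. u \<le> s \<Longrightarrow> s \<le> r \<Longrightarrow> r \<le> ?T \<Longrightarrow>
        filter (\<lambda>e. fst e \<le> s) ?es = filter (\<lambda>e. fst e \<le> r) ?es \<Longrightarrow> goal r \<Longrightarrow> goal s"
    for goal t
  proof -
    let ?P = "\<lambda>t. goal t \<or> settled_qty S t \<omega> = x_hat"
    have P_stable: "?P s" if s: "s \<in> fst ` set ?es" "u \<le> s" "s \<le> r" "r \<le> ?T"
      "filter (\<lambda>e. fst e \<le> s) ?es = filter (\<lambda>e. fst e \<le> r) ?es" "?P r" for s r
    proof -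
      \<comment> \<open>Every live fill is an entry, so equal entry filters force the same settled
        fills.\<close>
      have "settled_by s (live S \<omega>) = settled_by r (live S \<omega>)"
      proof -
        have "settle_time f \<le> s" if "f \<in> set (live S \<omega>)" "settle_time f \<le> r" for f
        proof -
          have "(settle_time f, proceeds f) \<in> set (filter (\<lambda>e. fst e \<le> s) ?es)"
            unfolding s(5) using that by (auto simp: ledger_entries_def)
          then show ?thesis by simp
        qed
        then show ?thesis
          unfolding settled_by_def using s(3) by (intro filter_cong) auto
      qed
      with s goal_stable[of s r] show ?thesis by (auto simp: settled_qty_def)
    qed
    have "t \<in> {u..?T}" "\<exists>e\<in>set ?es. fst e \<le> t"
      using t(1) first by (auto simp: entry)
    note first_entry = first_time_is_entry[where P = ?P, OF this t(2)]
    obtain \<sigma> where \<sigma>: "\<sigma> \<in> fst ` set ?es" "\<sigma> \<in> {u..t}" "?P \<sigma>"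
        "\<And>s. s < \<sigma> \<Longrightarrow> \<exists>e\<in>set ?es. fst e \<le> s \<Longrightarrow> \<not> ?P s"
      by (rule first_entry) (rule P_stable, assumption+, rule that)
    have in_horizon: "\<sigma> \<in> {first_applied S \<omega>..?T}"
      using \<sigma>(1,2) t(1) entry[of \<sigma>] by auto
    then have "?covers \<sigma>" using \<sigma>(3) goal_covers settled_covers by blast
    then have "debt_cleared_at S \<omega> \<sigma> \<and> remaining_cash S u \<sigma> \<omega> \<ge> buffer S"
      using covers_clears in_horizon by blast
    moreover have "completion_time S u \<Delta> x_hat \<omega> goal \<sigma>"
      using \<sigma>(3,4) in_horizon by (auto simp: completion_time_def entry)
    ultimately show ?thesis using \<sigma>(2) t(1) by auto
  qed
  show ?thesis
  proof (intro conjI impI)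
    obtain t where t: "t \<in> {first_applied S \<omega>..?T}" "debt S t \<omega> = 0 \<or> settled_qty S t \<omega> = x_hat"
      using continues can_act by (auto simp: continues_until_def)
    then have tT: "t \<in> {u..?T}" using first by auto
    \<comment> \<open>Stopping at the cap also clears the debt, through coverage.\<close>
    have "debt S t \<omega> = 0"
      using t covers_clears[OF t(1)] settled_covers[OF t(1)] by (auto simp: debt_cleared_at_def)
    then obtain \<sigma> where "\<sigma> \<in> {u..t}" "debt S \<sigma> \<omega> = 0" "0 \<le> remaining_cash S u \<sigma> \<omega>"
      using extinction_leaves_nonneg_cash[OF tT] by blast
    with tT show "\<exists>\<sigma>\<in>{u..?T}. debt_cleared_at S \<omega> \<sigma> \<and> remaining_cash S u \<sigma> \<omega> \<ge> 0"
      by (intro bexI[of _ \<sigma>]) (auto intro: debt_cleared_atI)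
  next
    assume "continues_until S u \<Delta> x_hat \<omega> ?covers"
    then obtain t where "t \<in> {first_applied S \<omega>..?T}" "?covers t \<or> settled_qty S t \<omega> = x_hat"
      using can_act by (auto simp: continues_until_def)
    then show "\<exists>\<sigma>\<in>{u..?T}. completion_time S u \<Delta> x_hat \<omega> ?covers \<sigma> \<and>
        debt_cleared_at S \<omega> \<sigma> \<and> remaining_cash S u \<sigma> \<omega> \<ge> buffer S"
      using completion covers_stable by blast
  next
    assume "settled_qty S ?T \<omega> = x_hat"
    then show "\<exists>\<sigma>\<in>{u..?T}. completion_time S u \<Delta> x_hat \<omega> (\<lambda>_. False) \<sigma> \<and>
        debt_cleared_at S \<omega> \<sigma> \<and> remaining_cash S u \<sigma> \<omega> \<ge> buffer S"
      using completion[of ?T "\<lambda>_. False"] first by auto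
  qed
qed

end
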